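(* Let $x$ and $y$ be reordered computable numbers. Then the product $x\cdot y$ is also reordered computable.
   Context: $\mathbb{N}=\{0,1,2,\dots\}$. A function $f\colon\mathbb{N}\to\mathbb{N}$ tends to infinity if for every $c$ there is $m$ with $f(n)>c$ for all $n\ge m$. For such $f$, $u_f(n) := |\{k\in\mathbb{N} \mid f(k)=n\}|$. A function $f\colon\mathbb{N}\to\mathbb{N}$ is a name for a real number $x$ if $\sum_{k=0}^\infty 2^{-f(k)} = x$ (then $f$ tends to infinity). A convergent sequence $(x_n)_n$ with limit $x$ converges computably if there is a computable $s\colon\mathbb{N}\to\mathbb{N}$ with $|x-x_k|\le 2^{-n}$ for all $n$ and all $k\ge s(n)$; a series converges computably if the sequence of its partial sums $\left(\sum_{k=0}^{n-1}a_k\right)_n$ does (no computability of the terms is required). A real number is reordered computable if it has a computable name $f$ such that $\sum_{k=0}^\infty u_f(k)\cdot 2^{-k}$ converges computably. *)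

theory Defs
  imports Complex_Main
begin

text \<open>Computability of functions on the natural numbers, via Kleene's partial recursive
  functions. Programs carry no arity: the length of the argument list is not fixed, and a program
  simply has no value on lists that are too short for it. The recursion argument of primitive
  recursion and the search variable of minimisation are the head of the argument list.\<close>

datatype recf =
    Zero
  | Succ
  | Proj nat
  | Comp recf "recf list"
  | PrimRec recf recf
  | Mu recf

inductive evaluates :: "recf \<Rightarrow> nat list \<Rightarrow> nat \<Rightarrow> bool" where
  zero: "evaluates Zero xs 0"
| succ: "evaluates Succ [x] (Suc x)"
| proj: "i < length xs \<Longrightarrow> evaluates (Proj i) xs (xs ! i)"
| comp: "list_all2 (\<lambda>g y. evaluates g xs y) gs ys \<Longrightarrow> evaluates f ys z \<Longrightarrow>
    evaluates (Comp f gs) xs z"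
| prim_rec_0: "evaluates f xs z \<Longrightarrow> evaluates (PrimRec f g) (0 # xs) z"
| prim_rec_Suc: "evaluates (PrimRec f g) (n # xs) r \<Longrightarrow> evaluates g (n # r # xs) z \<Longrightarrow>
    evaluates (PrimRec f g) (Suc n # xs) z"
| mu: "evaluates f (n # xs) 0 \<Longrightarrow> (\<forall>i<n. \<exists>v. evaluates f (i # xs) (Suc v)) \<Longrightarrow>
    evaluates (Mu f) xs n"

lemma evaluates_deterministic: "evaluates p xs y \<Longrightarrow> evaluates p xs z \<Longrightarrow> y = z"
proof (induction arbitrary: z rule: evaluates.induct)
  case (zero xs)
  then show ?case by (cases rule: evaluates.cases) auto
next
  case (succ x)
  then show ?case by (cases rule: evaluates.cases) auto
next
  case (proj i xs)
  from proj(2) show ?case by (cases rule: evaluates.cases) auto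
next
  case (comp xs gs ys f z')
  from comp.prems obtain ys' where
    1: "list_all2 (\<lambda>g y. evaluates g xs y) gs ys'" and 2: "evaluates f ys' z"
    by (cases rule: evaluates.cases) auto
  have "ys = ys'"
    using 1 comp.IH(1) by (auto simp: list_all2_conv_all_nth intro!: nth_equalityI)
  with 2 comp.IH(2) show ?case by simp
next
  case (prim_rec_0 f xs z' g)
  from prim_rec_0.prems show ?case
    by (cases rule: evaluates.cases) (auto intro: prim_rec_0.IH)
next
  case (prim_rec_Suc f g n xs r z')
  from prim_rec_Suc.prems obtain r' where
    "evaluates (PrimRec f g) (n # xs) r'" "evaluates g (n # r' # xs) z"
    by (cases rule: evaluates.cases) auto
  with prim_rec_Suc.IH show ?case by metis
next
  case (mu f n xs)
  from mu.prems have 1: "evaluates f (z # xs) 0"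
    and 2: "\<forall>i<z. \<exists>v. evaluates f (i # xs) (Suc v)"
    by (cases rule: evaluates.cases; auto)+
  have "\<not> n < z" using mu.IH(1) 2 by fastforce
  moreover have "\<not> z < n" using mu.IH(2) 1 by fastforce
  ultimately show ?case by simp
qed

definition computable :: "(nat \<Rightarrow> nat) \<Rightarrow> bool" where
  "computable f \<longleftrightarrow> (\<exists>p. \<forall>n. evaluates p [n] (f n))"

definition converges_computably :: "(nat \<Rightarrow> real) \<Rightarrow> bool" where
  "converges_computably a \<longleftrightarrow>
    (\<exists>x. a \<longlonglongrightarrow> x \<and>
      (\<exists>s. computable s \<and> (\<forall>n. \<forall>k\<ge>s n. \<bar>x - a k\<bar> \<le> 1 / 2 ^ n)))"

definition series_converges_computably :: "(nat \<Rightarrow> real) \<Rightarrow> bool" where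
  "series_converges_computably a \<longleftrightarrow> converges_computably (\<lambda>n. \<Sum>k<n. a k)"

definition is_name :: "(nat \<Rightarrow> nat) \<Rightarrow> real \<Rightarrow> bool" where
  "is_name f x \<longleftrightarrow> (\<lambda>k. 1 / 2 ^ f k) sums x"

definition multiplicity_of :: "(nat \<Rightarrow> nat) \<Rightarrow> nat \<Rightarrow> nat" where
  "multiplicity_of f n = card {k. f k = n}"

text \<open>A name tends to infinity, so the sets counted above are finite for names.\<close>

lemma is_name_tends_to_infinity:
  assumes "is_name f x"
  shows "filterlim f at_top sequentially"
proof -
  have lim: "(\<lambda>k. 1 / 2 ^ f k :: real) \<longlonglongrightarrow> 0"
    using assms unfolding is_name_def by (blast intro: summable_LIMSEQ_zero sums_summable)
  show ?thesis unfolding filterlim_at_top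
  proof
    fix c
    have "\<forall>\<^sub>F k in sequentially. 1 / 2 ^ f k < (1 / 2 ^ c :: real)"
      using lim by (rule order_tendstoD) simp
    then show "\<forall>\<^sub>F k in sequentially. c \<le> f k"
      by eventually_elim (simp add: field_simps)
  qed
qed

lemma is_name_finite_fibre:
  assumes "is_name f x"
  shows "finite {k. f k = n}"
proof -
  have "\<forall>\<^sub>F k in sequentially. Suc n \<le> f k"
    using is_name_tends_to_infinity[OF assms] by (simp add: filterlim_at_top)
  then obtain m where "\<And>k. k \<ge> m \<Longrightarrow> Suc n \<le> f k"
    by (auto simp: eventually_sequentially)
  then have "{k. f k = n} \<subseteq> {..<m}" by (force simp: not_le[symmetric])
  then show ?thesis by (rule finite_subset) simp
qed

definition reordered_computable :: "real \<Rightarrow> bool" where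
  "reordered_computable x \<longleftrightarrow>
    (\<exists>f. computable f \<and> is_name f x \<and>
      series_converges_computably (\<lambda>k. real (multiplicity_of f k) * (1 / 2 ^ k)))"

end

theory Submission
  imports Defs "HOL-Library.Nat_Bijection" "HOL-Analysis.Analysis"
begin

text \<open>
  Let \<open>f\<close> and \<open>g\<close> be names of \<open>x\<close> and \<open>y\<close> as in the definition of reordered computability. Multiplying
  out the two series gives \<open>x * y = (\<Sum>(i, j). 2 ^ - (f i + g j))\<close>, so enumerating all pairs by a
  computable bijection turns \<open>(i, j) \<mapsto> f i + g j\<close> into a computable name \<open>h\<close> of \<open>x * y\<close>. This is
  \<open>is_name_product\<close> together with \<open>computable_sum_prod_decode\<close>.

  The partial sum \<open>(\<Sum>k<N. u\<^sub>f(k) * 2 ^ - k)\<close> collects exactly those terms of the series of \<open>f\<close>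
  whose exponent is below \<open>N\<close> (\<open>sum_multiplicity_eq\<close>), and hence tends to \<open>x\<close> from below. If \<open>f i\<close>
  and \<open>g j\<close> are both below \<open>M\<close> then \<open>f i + g j < 2 * M\<close>. So the partial sum for \<open>h\<close> at any
  \<open>N \<ge> 2 * M\<close> contains the whole product of the partial sums \<open>A\<close> for \<open>f\<close> and \<open>B\<close> for \<open>g\<close> at \<open>M\<close>,
  while it never exceeds \<open>x * y\<close>. Its error is therefore at most
  \<open>x * y - A * B = (x - A) * y + A * (y - B)\<close>, which is at most \<open>x + y\<close> times a common bound on the
  errors of \<open>A\<close> and \<open>B\<close>. Bounding \<open>x + y\<close> by a power \<open>2 ^ c\<close>, a precision of \<open>n + c\<close> bits for both
  factors guarantees \<open>n\<close> bits for the product, so computable moduli \<open>s\<close> and \<open>t\<close> for the factors yield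
  the computable modulus \<open>n \<mapsto> 2 * (s (n + c) + t (n + c))\<close>.
\<close>

section \<open>Closure properties of computable functions\<close>

text \<open>A function of several arguments takes them as a list, which is how programs take theirs; the
  arity fixes the length of the lists on which a program has to agree with the function.\<close>

definition recursive :: "nat \<Rightarrow> (nat list \<Rightarrow> nat) \<Rightarrow> bool" where
  "recursive k F \<longleftrightarrow> (\<exists>p. \<forall>xs. length xs = k \<longrightarrow> evaluates p xs (F xs))"

lemma recursive_cong:
  assumes "recursive k F" and "\<And>xs. length xs = k \<Longrightarrow> F xs = G xs"
  shows "recursive k G"
  using assms unfolding recursive_def by metis

lemma computable_iff_recursive: "computable f \<longleftrightarrow> recursive 1 (\<lambda>xs. f (xs ! 0))"
proof -
  have "(\<forall>n. evaluates p [n] (f n)) \<longleftrightarrow>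
      (\<forall>xs. length xs = 1 \<longrightarrow> evaluates p xs (f (xs ! 0)))" for p
    by (auto simp: length_Suc_conv)
  then show ?thesis unfolding computable_def recursive_def by simp
qed

lemma recursive_zero: "recursive k (\<lambda>_. 0)"
  unfolding recursive_def by (blast intro: evaluates.zero)

lemma recursive_proj: "i < k \<Longrightarrow> recursive k (\<lambda>xs. xs ! i)"
  unfolding recursive_def by (blast intro: evaluates.proj)

lemma recursive_comp:
  assumes "computable f" and "recursive k F"
  shows "recursive k (\<lambda>xs. f (F xs))"
proof -
  obtain p q where "\<forall>n. evaluates p [n] (f n)"
    and "\<forall>xs. length xs = k \<longrightarrow> evaluates q xs (F xs)"
    using assms unfolding computable_def recursive_def by blast
  then have "\<forall>xs. length xs = k \<longrightarrow> evaluates (Comp p [q]) xs (f (F xs))"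
    by (auto intro!: evaluates.comp)
  then show ?thesis unfolding recursive_def by blast
qed

lemma recursive_comp2:
  assumes "recursive 2 (\<lambda>xs. f (xs ! 0) (xs ! 1))" and "recursive k F" and "recursive k G"
  shows "recursive k (\<lambda>xs. f (F xs) (G xs))"
proof -
  obtain p q r where p: "\<forall>xs. length xs = 2 \<longrightarrow> evaluates p xs (f (xs ! 0) (xs ! 1))"
    and q: "\<forall>xs. length xs = k \<longrightarrow> evaluates q xs (F xs)"
    and r: "\<forall>xs. length xs = k \<longrightarrow> evaluates r xs (G xs)"
    using assms unfolding recursive_def by blast
  have "evaluates p [a, b] (f a b)" for a b
    using p[rule_format, of "[a, b]"] by simp
  then have "\<forall>xs. length xs = k \<longrightarrow> evaluates (Comp p [q, r]) xs (f (F xs) (G xs))"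
    using q r by (auto intro!: evaluates.comp[where ys = "[F _, G _]"])
  then show ?thesis unfolding recursive_def by blast
qed

lemma recursive_prim_rec:
  assumes "recursive k F" and "recursive (Suc (Suc k)) G"
    and zero: "\<And>xs. length xs = k \<Longrightarrow> H (0 # xs) = F xs"
    and suc: "\<And>n xs. length xs = k \<Longrightarrow> H (Suc n # xs) = G (n # H (n # xs) # xs)"
  shows "recursive (Suc k) H"
proof -
  obtain p q where p: "\<forall>xs. length xs = k \<longrightarrow> evaluates p xs (F xs)"
    and q: "\<forall>xs. length xs = Suc (Suc k) \<longrightarrow> evaluates q xs (G xs)"
    using assms(1,2) unfolding recursive_def by blast
  have "evaluates (PrimRec p q) (n # xs) (H (n # xs))" if "length xs = k" for n xs
    using that
    by (induction n) (auto simp: zero suc p q intro: evaluates.prim_rec_0 evaluates.prim_rec_Suc)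
  then show ?thesis unfolding recursive_def by (auto simp: length_Suc_conv)
qed

lemma recursive_least:
  assumes "recursive (Suc k) F" and "\<And>xs. length xs = k \<Longrightarrow> \<exists>n. F (n # xs) = 0"
  shows "recursive k (\<lambda>xs. LEAST n. F (n # xs) = 0)"
proof -
  obtain p where p: "\<forall>xs. length xs = Suc k \<longrightarrow> evaluates p xs (F xs)"
    using assms(1) unfolding recursive_def by blast
  have "evaluates (Mu p) xs (LEAST n. F (n # xs) = 0)" if len: "length xs = k" for xs
  proof (rule evaluates.mu)
    have "F ((LEAST n. F (n # xs) = 0) # xs) = 0"
      using assms(2)[OF len] by (rule LeastI_ex)
    then show "evaluates p ((LEAST n. F (n # xs) = 0) # xs) 0"
      using p len by (metis length_Cons)
    show "\<forall>i<LEAST n. F (n # xs) = 0. \<exists>v. evaluates p (i # xs) (Suc v)"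
    proof (intro allI impI)
      fix i assume "i < (LEAST n. F (n # xs) = 0)"
      then have "F (i # xs) \<noteq> 0" by (rule not_less_Least)
      then obtain v where "F (i # xs) = Suc v" by (cases "F (i # xs)") auto
      then show "\<exists>v. evaluates p (i # xs) (Suc v)"
        using p len by (metis length_Cons)
    qed
  qed
  then show ?thesis unfolding recursive_def by blast
qed

lemma computable_Suc: "computable Suc"
  unfolding computable_def by (blast intro: evaluates.succ)

lemma recursive_add:
  assumes "recursive k F" and "recursive k G"
  shows "recursive k (\<lambda>xs. F xs + G xs)"
proof -
  have "recursive (Suc 1) (\<lambda>xs. xs ! 0 + xs ! 1)"
    by (rule recursive_prim_rec[where F = "\<lambda>xs. xs ! 0" and G = "\<lambda>xs. Suc (xs ! 1)"])
      (auto intro!: recursive_proj recursive_comp[OF computable_Suc])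
  then show ?thesis
    using recursive_comp2[of "(+)"] assms by (simp add: numeral_2_eq_2)
qed

lemma computable_pred: "computable (\<lambda>n. n - 1)"
proof -
  have "recursive (Suc 0) (\<lambda>xs. xs ! 0 - 1)"
    by (rule recursive_prim_rec[where F = "\<lambda>_. 0" and G = "\<lambda>xs. xs ! 0"])
      (auto intro!: recursive_proj recursive_zero)
  then show ?thesis by (simp add: computable_iff_recursive)
qed

lemma recursive_diff:
  assumes "recursive k F" and "recursive k G"
  shows "recursive k (\<lambda>xs. F xs - G xs)"
proof -
  \<comment> \<open>The recursion argument comes first, so the subtrahend does.\<close>
  have "recursive (Suc (Suc 1)) (\<lambda>xs. xs ! 1 - 1)"
    by (rule recursive_comp[OF computable_pred recursive_proj]) simp
  then have "recursive (Suc 1) (\<lambda>xs. xs ! 1 - xs ! 0)"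
    by (rule recursive_prim_rec[where F = "\<lambda>xs. xs ! 0", rotated])
      (auto intro!: recursive_proj)
  then show ?thesis
    using recursive_comp2[of "\<lambda>a b. b - a" k G F] assms by (simp add: numeral_2_eq_2)
qed

lemma computable_triangle: "computable triangle"
proof -
  have "recursive (Suc 0) (\<lambda>xs. triangle (xs ! 0))"
    by (rule recursive_prim_rec[where F = "\<lambda>_. 0" and G = "\<lambda>xs. xs ! 1 + Suc (xs ! 0)"])
      (auto intro!: recursive_proj recursive_zero recursive_add recursive_comp[OF computable_Suc])
  then show ?thesis by (simp add: computable_iff_recursive)
qed

lemma recursive_const: "recursive k (\<lambda>_. c)"
  by (induction c) (auto intro: recursive_zero recursive_comp[OF computable_Suc])

section \<open>Computable decoding of pairs\<close>

text \<open>A number lies on the diagonal \<open>d\<close> of the enumeration of pairs when it is at least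
  \<open>triangle d\<close> and less than \<open>triangle (Suc d)\<close>. Finding \<open>d\<close> by unbounded search turns decoding into
  subtraction.\<close>

lemma diagonal_prod_decode:
  "(LEAST d. n < triangle (Suc d)) = fst (prod_decode n) + snd (prod_decode n)"
proof -
  obtain a b where ab: "prod_decode n = (a, b)" by fastforce
  have n: "n = triangle (a + b) + a"
    using prod_decode_inverse[of n] by (simp add: ab prod_encode_def)
  have mono: "triangle d \<le> triangle e" if "d \<le> e" for d e
    using that by (induction rule: dec_induct) auto
  have "(LEAST d. n < triangle (Suc d)) = a + b"
  proof (rule Least_equality)
    fix d assume d: "n < triangle (Suc d)"
    show "a + b \<le> d"
    proof (rule ccontr)
      assume "\<not> a + b \<le> d"
      then have "triangle (Suc d) \<le> triangle (a + b)" by (intro mono) simp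
      with d n show False by linarith
    qed
  qed (simp add: n)
  then show ?thesis by (simp add: ab)
qed

lemma computable_diagonal: "computable (\<lambda>n. fst (prod_decode n) + snd (prod_decode n))"
proof -
  have "recursive (Suc 1) (\<lambda>xs. Suc (xs ! 1) - triangle (Suc (xs ! 0)))"
    by (intro recursive_diff recursive_comp[OF computable_Suc] recursive_comp[OF computable_triangle]
        recursive_proj) auto
  then have "recursive 1 (\<lambda>xs. LEAST d. Suc ((d # xs) ! 1) - triangle (Suc ((d # xs) ! 0)) = 0)"
  proof (rule recursive_least)
    fix xs :: "nat list"
    have "Suc (xs ! 0) - triangle (Suc (xs ! 0)) = 0" by simp
    then show "\<exists>d. Suc ((d # xs) ! 1) - triangle (Suc ((d # xs) ! 0)) = 0"
      by (intro exI[of _ "xs ! 0"]) simp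
  qed
  then have "recursive 1 (\<lambda>xs. LEAST d. xs ! 0 < triangle (Suc d))"
    by (simp add: Suc_le_eq del: triangle_Suc)
  then show ?thesis
    by (simp only: computable_iff_recursive diagonal_prod_decode)
qed

lemma computable_fst_prod_decode: "computable (\<lambda>n. fst (prod_decode n))"
proof -
  let ?d = "\<lambda>n. fst (prod_decode n) + snd (prod_decode n)"
  have "n - triangle (?d n) = fst (prod_decode n)" for n
  proof -
    have "n = triangle (?d n) + fst (prod_decode n)"
      by (metis prod_decode_inverse prod_encode_def case_prod_beta)
    then show ?thesis by linarith
  qed
  moreover have "recursive 1 (\<lambda>xs. xs ! 0 - triangle (?d (xs ! 0)))"
    by (intro recursive_diff recursive_comp[OF computable_triangle]
        recursive_comp[OF computable_diagonal] recursive_proj) auto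
  ultimately show ?thesis by (simp add: computable_iff_recursive)
qed

lemma computable_snd_prod_decode: "computable (\<lambda>n. snd (prod_decode n))"
proof -
  have "recursive 1 (\<lambda>xs. (fst (prod_decode (xs ! 0)) + snd (prod_decode (xs ! 0)))
      - fst (prod_decode (xs ! 0)))"
    by (intro recursive_diff recursive_comp[OF computable_diagonal]
        recursive_comp[OF computable_fst_prod_decode] recursive_proj) auto
  then show ?thesis by (simp add: computable_iff_recursive)
qed

lemma computable_sum_prod_decode:
  assumes "computable f" and "computable g"
  shows "computable (\<lambda>n. f (fst (prod_decode n)) + g (snd (prod_decode n)))"
  unfolding computable_iff_recursive
  by (intro recursive_add recursive_comp[OF assms(1)] recursive_comp[OF assms(2)]
      recursive_comp[OF computable_fst_prod_decode] recursive_comp[OF computable_snd_prod_decode]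
      recursive_proj) auto

section \<open>Names as unconditional sums\<close>

lemma is_name_iff_has_sum: "is_name f x \<longleftrightarrow> ((\<lambda>k. 1 / 2 ^ f k) has_sum x) UNIV"
  unfolding is_name_def by (auto intro: sums_nonneg_imp_has_sum has_sum_imp_sums)

lemma is_name_nonneg: "is_name f x \<Longrightarrow> 0 \<le> x"
  unfolding is_name_iff_has_sum by (rule has_sum_nonneg) auto

lemma finite_name_below:
  assumes "is_name f x"
  shows "finite {k. f k < N}"
proof -
  have "{k. f k < N} = (\<Union>n<N. {k. f k = n})" by auto
  then show ?thesis using is_name_finite_fibre[OF assms] by simp
qed

lemma sum_multiplicity_eq:
  assumes "is_name f x"
  shows "(\<Sum>n<N. real (multiplicity_of f n) * (1 / 2 ^ n)) = (\<Sum>k | f k < N. 1 / 2 ^ f k)"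
proof -
  have "(\<Sum>k | f k < N. 1 / 2 ^ f k)
      = (\<Sum>n<N. \<Sum>k\<in>{k \<in> {k. f k < N}. f k = n}. 1 / 2 ^ f k :: real)"
    by (rule sum.group[symmetric]) (auto simp: finite_name_below[OF assms])
  also have "\<dots> = (\<Sum>n<N. real (multiplicity_of f n) * (1 / 2 ^ n))"
  proof (rule sum.cong)
    fix n assume "n \<in> {..<N}"
    then have "{k \<in> {k. f k < N}. f k = n} = {k. f k = n}" by auto
    then show "(\<Sum>k\<in>{k \<in> {k. f k < N}. f k = n}. 1 / 2 ^ f k)
        = real (multiplicity_of f n) * (1 / 2 ^ n)"
      by (simp add: multiplicity_of_def)
  qed simp
  finally show ?thesis ..
qed

lemma sum_name_below_le:
  assumes "is_name f x"
  shows "(\<Sum>k | f k < N. 1 / 2 ^ f k) \<le> x"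
  using assms unfolding is_name_iff_has_sum
  by (rule finite_sum_le_has_sum) (auto simp: finite_name_below[OF assms])

text \<open>The sets \<open>{k. f k < N}\<close> are finite and exhaust the natural numbers, so summing along them is
  one of the rearrangements that the unconditional sum allows.\<close>

lemma sum_multiplicity_tendsto:
  assumes "is_name f x"
  shows "(\<lambda>N. \<Sum>n<N. real (multiplicity_of f n) * (1 / 2 ^ n)) \<longlonglongrightarrow> x"
proof -
  have "filterlim (\<lambda>N. {k. f k < N}) finite_sets_at_top sequentially"
    unfolding filterlim_finite_subsets_at_top
  proof safe
    fix X :: "nat set" assume "finite X"
    then have "finite (f ` X)" by simp
    then obtain m where m: "f ` X \<subseteq> {..<m}" by (auto simp: finite_nat_set_iff_bounded)
    show "\<forall>\<^sub>F N in sequentially. finite {k. f k < N} \<and> X \<subseteq> {k. f k < N} \<and> {k. f k < N} \<subseteq> UNIV"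
      using eventually_ge_at_top[of m]
      by eventually_elim (use m finite_name_below[OF assms] in fastforce)
  qed
  then have "(\<lambda>N. \<Sum>k | f k < N. 1 / 2 ^ f k :: real) \<longlonglongrightarrow> x"
    using assms unfolding is_name_iff_has_sum has_sum_def by (rule filterlim_compose[rotated])
  then show ?thesis by (simp only: sum_multiplicity_eq[OF assms])
qed

text \<open>The limit in the definition of computable convergence is the named number itself, so the
  modulus bounds the sum of the terms of exponent at least \<open>s n\<close>.\<close>

lemma reordered_computableE:
  assumes "reordered_computable x"
  obtains f s where "computable f" "is_name f x" "computable s"
    "\<And>n N. s n \<le> N \<Longrightarrow> x - (\<Sum>k | f k < N. 1 / 2 ^ f k) \<le> 1 / 2 ^ n"
proof -
  obtain f x' s where f: "computable f" "is_name f x" and s: "computable s"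
    and lim: "(\<lambda>N. \<Sum>n<N. real (multiplicity_of f n) * (1 / 2 ^ n)) \<longlonglongrightarrow> x'"
    and bound: "\<forall>n. \<forall>N\<ge>s n. \<bar>x' - (\<Sum>k<N. real (multiplicity_of f k) * (1 / 2 ^ k))\<bar> \<le> 1 / 2 ^ n"
    using assms
    unfolding reordered_computable_def series_converges_computably_def converges_computably_def
    by blast
  have "x' = x"
    using lim sum_multiplicity_tendsto[OF f(2)] by (rule LIMSEQ_unique)
  then have "x - (\<Sum>k | f k < N. 1 / 2 ^ f k) \<le> 1 / 2 ^ n" if "s n \<le> N" for n N
    using bound that unfolding sum_multiplicity_eq[OF f(2)] by (meson abs_le_D1)
  with f s show thesis by (rule that)
qed

text \<open>All partial sums lie below the limit, so it suffices to bound the error from above.\<close>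

lemma reordered_computableI:
  assumes "computable f" and name: "is_name f x" and "computable s"
    and "\<And>n N. s n \<le> N \<Longrightarrow> x - (\<Sum>k | f k < N. 1 / 2 ^ f k) \<le> 1 / 2 ^ n"
  shows "reordered_computable x"
proof -
  have "\<bar>x - (\<Sum>k<N. real (multiplicity_of f k) * (1 / 2 ^ k))\<bar> \<le> 1 / 2 ^ n" if "s n \<le> N" for n N
    using assms(4)[OF that] sum_name_below_le[OF name, of N]
    unfolding sum_multiplicity_eq[OF name] by linarith
  then show ?thesis
    using assms(1-3) sum_multiplicity_tendsto[OF name]
    unfolding reordered_computable_def series_converges_computably_def converges_computably_def
    by blast
qed

section \<open>The product\<close>

lemma has_sum_product_nonneg:
  fixes a :: "'a \<Rightarrow> real" and b :: "'b \<Rightarrow> real"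
  assumes a: "(a has_sum x) A" "\<And>i. i \<in> A \<Longrightarrow> 0 \<le> a i"
    and b: "(b has_sum y) B" "\<And>j. j \<in> B \<Longrightarrow> 0 \<le> b j"
  shows "((\<lambda>(i, j). a i * b j) has_sum (x * y)) (A \<times> B)"
proof -
  let ?t = "\<lambda>(i, j). a i * b j"
  have rows: "((\<lambda>j. ?t (i, j)) has_sum (a i * y)) B" for i
    using has_sum_cmult_right[OF b(1)] by simp
  have total: "((\<lambda>i. a i * y) has_sum (x * y)) A"
    using a(1) by (rule has_sum_cmult_left)
  have "?t summable_on A \<times> B"
    by (rule summable_on_SigmaI[where f = ?t, OF rows has_sum_imp_summable[OF total]]) (use a b in auto)
  then show ?thesis by (rule has_sum_SigmaI[where f = ?t, OF rows total])
qed

lemma is_name_product: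
  assumes "is_name f x" and "is_name g y"
  shows "is_name (\<lambda>n. f (fst (prod_decode n)) + g (snd (prod_decode n))) (x * y)"
proof -
  let ?t = "\<lambda>(i, j). 1 / 2 ^ f i * (1 / 2 ^ g j) :: real"
  have "(?t has_sum (x * y)) (UNIV \<times> UNIV)"
    using assms unfolding is_name_iff_has_sum by (intro has_sum_product_nonneg) auto
  then have "((\<lambda>n. ?t (prod_decode n)) has_sum (x * y)) UNIV"
    using has_sum_reindex_bij_betw[OF bij_prod_decode, of ?t] by simp
  then show ?thesis
    unfolding is_name_iff_has_sum by (simp add: case_prod_beta power_add)
qed

text \<open>The pairs with \<open>f i < M\<close> and \<open>g j < M\<close> form a rectangle, over which the sum factors, and all
  of them have \<open>f i + g j < 2 * M\<close>.\<close>

lemma product_name_below_ge: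
  assumes f: "is_name f x" and g: "is_name g y" and "2 * M \<le> N"
  defines "h \<equiv> \<lambda>n. f (fst (prod_decode n)) + g (snd (prod_decode n))"
  shows "(\<Sum>i | f i < M. 1 / 2 ^ f i) * (\<Sum>j | g j < M. 1 / 2 ^ g j)
    \<le> (\<Sum>k | h k < N. 1 / 2 ^ h k :: real)"
proof -
  let ?R = "{i. f i < M} \<times> {j. g j < M}"
  have "(\<Sum>i | f i < M. 1 / 2 ^ f i) * (\<Sum>j | g j < M. 1 / 2 ^ g j)
      = (\<Sum>p\<in>?R. 1 / 2 ^ (f (fst p) + g (snd p)) :: real)"
    by (simp add: sum_product sum.cartesian_product case_prod_beta power_add)
  also have "\<dots> = (\<Sum>k\<in>prod_encode ` ?R. 1 / 2 ^ h k)"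
    by (simp add: sum.reindex inj_prod_encode h_def)
  also have "\<dots> \<le> (\<Sum>k | h k < N. 1 / 2 ^ h k)"
  proof (rule sum_mono2)
    have "is_name h (x * y)" unfolding h_def by (rule is_name_product[OF f g])
    then show "finite {k. h k < N}" by (rule finite_name_below)
  qed (use \<open>2 * M \<le> N\<close> in \<open>auto simp: h_def\<close>)
  finally show ?thesis .
qed

theorem theorem17:
  fixes x y :: real
  assumes "reordered_computable x" and "reordered_computable y"
  shows "reordered_computable (x * y)"
proof -
  obtain f s where f: "computable f" "is_name f x" and s: "computable s"
    and s_bound: "\<And>n N. s n \<le> N \<Longrightarrow> x - (\<Sum>k | f k < N. 1 / 2 ^ f k) \<le> 1 / 2 ^ n"
    using assms(1) by (rule reordered_computableE) (rule that)
  obtain g t where g: "computable g" "is_name g y" and t: "computable t"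
    and t_bound: "\<And>n N. t n \<le> N \<Longrightarrow> y - (\<Sum>k | g k < N. 1 / 2 ^ g k) \<le> 1 / 2 ^ n"
    using assms(2) by (rule reordered_computableE) (rule that)
  obtain c where c: "x + y < 2 ^ c"
    using real_arch_pow[of 2 "x + y"] by auto
  define h where "h = (\<lambda>n. f (fst (prod_decode n)) + g (snd (prod_decode n)))"
  define M where "M n = s (n + c) + t (n + c)" for n
  have "recursive 1 (\<lambda>xs. M (xs ! 0) + M (xs ! 0))"
    unfolding M_def
    by (intro recursive_add recursive_comp[OF s] recursive_comp[OF t] recursive_proj recursive_const)
      auto
  then have modulus: "computable (\<lambda>n. 2 * M n)"
    by (simp add: computable_iff_recursive mult_2)
  have error: "x * y - (\<Sum>k | h k < N. 1 / 2 ^ h k) \<le> 1 / 2 ^ n" if N: "2 * M n \<le> N" for n N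
  proof -
    let ?A = "\<Sum>i | f i < M n. 1 / 2 ^ f i :: real"
    let ?B = "\<Sum>j | g j < M n. 1 / 2 ^ g j :: real"
    let ?e = "1 / 2 ^ (n + c) :: real"
    have A: "x - ?A \<le> ?e" "?A \<le> x"
      using s_bound[of "n + c" "M n"] sum_name_below_le[OF f(2)] by (auto simp: M_def)
    have B: "y - ?B \<le> ?e" "?B \<le> y"
      using t_bound[of "n + c" "M n"] sum_name_below_le[OF g(2)] by (auto simp: M_def)
    have "x * y - (\<Sum>k | h k < N. 1 / 2 ^ h k) \<le> x * y - ?A * ?B"
      using product_name_below_ge[OF f(2) g(2) N] by (simp add: h_def)
    also have "\<dots> = (x - ?A) * y + ?A * (y - ?B)" by (simp add: algebra_simps)
    also have "\<dots> \<le> ?e * y + x * ?e"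
      using A B is_name_nonneg[OF f(2)] is_name_nonneg[OF g(2)]
      by (intro add_mono mult_mono) (auto intro: sum_nonneg)
    also have "\<dots> = ?e * (x + y)" by (simp only: distrib_left mult.commute[of x])
    also have "\<dots> \<le> ?e * 2 ^ c" using c by (intro mult_left_mono) auto
    also have "\<dots> = 1 / 2 ^ n" by (simp add: power_add)
    finally show ?thesis .
  qed
  show ?thesis
  proof (rule reordered_computableI[OF _ _ modulus error])
    show "computable h" unfolding h_def by (rule computable_sum_prod_decode[OF f(1) g(1)])
    show "is_name h (x * y)" unfolding h_def by (rule is_name_product[OF f(2) g(2)])
  qed
qed

end
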